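(* Let $p$ be an odd prime. For every $\varepsilon>0$ there are sets $S,A\subseteq\mathbb F_p^{\omega}$ such that $d^*(A)>\frac12-\frac1{2p}-\varepsilon$, $S$ is dense in the Bohr topology of $\mathbb F_p^{\omega}$, and $S+A$ is not piecewise Bohr.
   Context: $\mathbb F_p^{\omega}=\bigoplus_{n=1}^{\infty}\mathbb F_p$ is the countable direct sum of copies of the field with $p$ elements, viewed as a countable abelian group. For subsets of an abelian group $G$ and $t\in G$: $A+B=\{a+b:a\in A,b\in B\}$ and $t+A=\{t+a:a\in A\}$. A Følner sequence for a countable abelian group $G$ is a sequence $\mathbf\Phi=(\Phi_n)_{n\in\mathbb N}$ of finite (nonempty) subsets of $G$ with $\lim_{n\to\infty}\frac{|(\Phi_n+g)\cap\Phi_n|}{|\Phi_n|}=1$ for every $g\in G$. The upper Banach density of $A\subseteq G$ is $d^*(A)=\sup_{\mathbf\Phi}\limsup_{n\to\infty}\frac{|A\cap\Phi_n|}{|\Phi_n|}$, the supremum being over all Følner sequences for $G$. A Bohr set in $G$ is a set of the form $\{g\in G:|\chi_j(g)-1|<\varepsilon,\ 1\le j\le k\}$, where $\varepsilon>0$ and $\chi_1,\dots,\chi_k:G\to\mathcal S^1=\{z\in\mathbb C:|z|=1\}$ are homomorphisms. A Bohr neighborhood is a set containing a translate of a Bohr set; the Bohr topology on $G$ is the topology whose neighborhoods are the Bohr neighborhoods, so $S\subseteq G$ is dense in the Bohr topology iff $S$ meets every translate of every Bohr set. A set $B\subseteq G$ is piecewise Bohr if there is a Bohr set $B'\subseteq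 G$ such that for every finite $F\subseteq B'$ there exists $t\in G$ with $t+F\subseteq B$. *)

theory Defs
  imports
    "HOL-Analysis.Analysis"
    "HOL-Library.Set_Algebras"
    "HOL-Library.Poly_Mapping"
    "Berlekamp_Zassenhaus.Finite_Field"
begin

(* The prime p is CARD('p), so 'p mod_ring is the field F_p; finitely supported functions on nat
   form the countable direct sum of copies of F_p. *)
type_synonym 'p Fp_omega = "nat \<Rightarrow>\<^sub>0 'p mod_ring"

definition folner_sequence :: "(nat \<Rightarrow> 'a::ab_group_add set) \<Rightarrow> bool" where
  "folner_sequence \<Phi> \<longleftrightarrow>
     (\<forall>n. finite (\<Phi> n) \<and> \<Phi> n \<noteq> {}) \<and>
     (\<forall>g. (\<lambda>n. real (card ((g +o \<Phi> n) \<inter> \<Phi> n)) / real (card (\<Phi> n))) \<longlonglongrightarrow> 1)"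

(* Valued in ereal because limsup and SUP are total there; for a countable group Folner sequences
   exist and the value lies in [0, 1]. *)
definition upper_banach_density :: "'a::ab_group_add set \<Rightarrow> ereal" where
  "upper_banach_density A =
     (SUP \<Phi>\<in>{\<Phi>. folner_sequence \<Phi>}.
        limsup (\<lambda>n. ereal (real (card (A \<inter> \<Phi> n)) / real (card (\<Phi> n)))))"

definition circle_character :: "('a::ab_group_add \<Rightarrow> complex) \<Rightarrow> bool" where
  "circle_character \<xi> \<longleftrightarrow>
     (\<forall>g. norm (\<xi> g) = 1) \<and> (\<forall>g h. \<xi> (g + h) = \<xi> g * \<xi> h)"

definition bohr_set :: "'a::ab_group_add set \<Rightarrow> bool" where
  "bohr_set B \<longleftrightarrow>
     (\<exists>(k::nat) \<xi> (\<epsilon>::real). \<epsilon> > 0 \<and> (\<forall>j\<in>{1..k}. circle_character (\<xi> j)) \<and>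
        B = {g. \<forall>j\<in>{1..k}. norm (\<xi> j g - 1) < \<epsilon>})"

definition bohr_neighborhood :: "'a::ab_group_add \<Rightarrow> 'a set \<Rightarrow> bool" where
  "bohr_neighborhood t N \<longleftrightarrow> (\<exists>B. bohr_set B \<and> t +o B \<subseteq> N)"

definition bohr_topology :: "'a::ab_group_add topology" where
  "bohr_topology = topology (\<lambda>U. \<forall>t\<in>U. bohr_neighborhood t U)"

definition bohr_dense :: "'a::ab_group_add set \<Rightarrow> bool" where
  "bohr_dense S \<longleftrightarrow> bohr_topology closure_of S = UNIV"

definition piecewise_bohr :: "'a::ab_group_add set \<Rightarrow> bool" where
  "piecewise_bohr B \<longleftrightarrow>
     (\<exists>B'. bohr_set B' \<and> (\<forall>F. finite F \<and> F \<subseteq> B' \<longrightarrow> (\<exists>t. t +o F \<subseteq> B)))"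

lemma circle_character_zero:
  assumes "circle_character \<xi>"
  shows "\<xi> 0 = 1"
proof -
  have "\<xi> 0 * \<xi> 0 = \<xi> 0" "\<xi> 0 \<noteq> 0"
    using assms unfolding circle_character_def by (metis add_0) (metis assms circle_character_def norm_zero zero_neq_one)
  then show ?thesis by simp
qed

lemma zero_in_bohr_set: "bohr_set B \<Longrightarrow> 0 \<in> B"
  by (auto simp: bohr_set_def circle_character_zero)

lemma bohr_set_Int:
  assumes "bohr_set B" "bohr_set C"
  obtains D where "bohr_set D" "D \<subseteq> B \<inter> C"
proof -
  obtain k :: nat and \<xi> and d :: real where B: "d > 0" "\<forall>j\<in>{1..k}. circle_character (\<xi> j)"
    "B = {g. \<forall>j\<in>{1..k}. norm (\<xi> j g - 1) < d}" using assms(1) unfolding bohr_set_def by blast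
  obtain l :: nat and \<psi> and e :: real where C: "e > 0" "\<forall>j\<in>{1..l}. circle_character (\<psi> j)"
    "C = {g. \<forall>j\<in>{1..l}. norm (\<psi> j g - 1) < e}" using assms(2) unfolding bohr_set_def by blast
  define \<phi> where "\<phi> j = (if j \<le> k then \<xi> j else \<psi> (j - k))" for j
  define D where "D = {g. \<forall>j\<in>{1..k+l}. norm (\<phi> j g - 1) < min d e}"
  have "\<forall>j\<in>{1..k+l}. circle_character (\<phi> j)"
  proof
    fix j assume "j \<in> {1..k+l}"
    then have "j \<in> {1..k} \<or> j > k \<and> j - k \<in> {1..l}" by auto
    then show "circle_character (\<phi> j)" using B(2) C(2) by (auto simp: \<phi>_def)
  qed
  then have "bohr_set D"
    unfolding bohr_set_def D_def using B(1) C(1)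
    by (intro exI[of _ "k+l"] exI[of _ \<phi>] exI[of _ "min d e"]) auto
  moreover have "D \<subseteq> B \<inter> C"
  proof
    fix g assume g: "g \<in> D"
    have "norm (\<xi> j g - 1) < d" if "j \<in> {1..k}" for j
      using g that unfolding D_def by (auto simp: \<phi>_def dest!: bspec[of _ _ j])
    moreover have "norm (\<psi> j g - 1) < e" if "j \<in> {1..l}" for j
      using g that unfolding D_def by (auto simp: \<phi>_def dest!: bspec[of _ _ "j + k"])
    ultimately show "g \<in> B \<inter> C" using B(3) C(3) by auto
  qed
  ultimately show ?thesis using that by blast
qed

lemma istopology_bohr: "istopology (\<lambda>U. \<forall>t\<in>U. bohr_neighborhood t U)"
  unfolding istopology_def
proof (intro conjI allI impI ballI)
  fix S T :: "'a set" and t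
  assume S: "\<forall>t\<in>S. bohr_neighborhood t S" and T: "\<forall>t\<in>T. bohr_neighborhood t T" and t: "t \<in> S \<inter> T"
  obtain B C where "bohr_set B" "t +o B \<subseteq> S" "bohr_set C" "t +o C \<subseteq> T"
    using S T t unfolding bohr_neighborhood_def by blast
  moreover obtain D where "bohr_set D" "D \<subseteq> B \<inter> C"
    using bohr_set_Int calculation by blast
  ultimately show "bohr_neighborhood t (S \<inter> T)"
    unfolding bohr_neighborhood_def elt_set_plus_def by blast
next
  fix \<K> :: "'a set set" and t
  assume "\<forall>K\<in>\<K>. \<forall>t\<in>K. bohr_neighborhood t K" "t \<in> \<Union>\<K>"
  then show "bohr_neighborhood t (\<Union>\<K>)"
    unfolding bohr_neighborhood_def by (meson Sup_upper UnionE order_trans)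
qed

lemma openin_bohr_topology:
  "openin bohr_topology U \<longleftrightarrow> (\<forall>t\<in>U. bohr_neighborhood t U)"
  unfolding bohr_topology_def using topology_inverse'[OF istopology_bohr] by metis

lemma openin_bohr_translate:
  assumes "bohr_set B"
  shows "openin bohr_topology (t +o B)"
  unfolding openin_bohr_topology
proof
  fix s assume "s \<in> t +o B"
  then obtain b where b: "b \<in> B" "s = t + b" by (auto simp: elt_set_plus_def)
  obtain k :: nat and \<xi> and d :: real where B: "d > 0" "\<forall>j\<in>{1..k}. circle_character (\<xi> j)"
    "B = {g. \<forall>j\<in>{1..k}. norm (\<xi> j g - 1) < d}" using assms unfolding bohr_set_def by blast
  define e where "e = Min (insert d ((\<lambda>j. d - norm (\<xi> j b - 1)) ` {1..k}))"
  have e: "e > 0" using B b by (auto simp: e_def)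
  define C where "C = {g. \<forall>j\<in>{1..k}. norm (\<xi> j g - 1) < e}"
  have C: "bohr_set C" unfolding bohr_set_def C_def using B(2) e by blast
  have "b + c \<in> B" if c: "c \<in> C" for c
    unfolding B(3)
  proof clarify
    fix j assume j: "j \<in> {1..k}"
    have \<xi>: "norm (\<xi> j b) = 1" "\<xi> j (b + c) = \<xi> j b * \<xi> j c"
      using B(2) j by (auto simp: circle_character_def)
    have "norm (\<xi> j (b + c) - 1) = norm (\<xi> j b * (\<xi> j c - 1) + (\<xi> j b - 1))"
      using \<xi>(2) by (simp add: algebra_simps)
    also have "\<dots> \<le> norm (\<xi> j c - 1) + norm (\<xi> j b - 1)"
      by (metis \<xi>(1) mult_1 norm_mult norm_triangle_ineq)
    also have "\<dots> < e + norm (\<xi> j b - 1)" using c j by (auto simp: C_def)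
    also have "e \<le> d - norm (\<xi> j b - 1)" unfolding e_def using j by (intro Min_le) auto
    finally show "norm (\<xi> j (b + c) - 1) < d" by simp
  qed
  then have "s +o C \<subseteq> t +o B" using b by (auto simp: elt_set_plus_def add.assoc)
  then show "bohr_neighborhood s (t +o B)" using C unfolding bohr_neighborhood_def by blast
qed

lemma bohr_dense_iff:
  "bohr_dense S \<longleftrightarrow> (\<forall>t B. bohr_set B \<longrightarrow> S \<inter> (t +o B) \<noteq> {})"
proof
  assume S: "bohr_dense S"
  show "\<forall>t B. bohr_set B \<longrightarrow> S \<inter> (t +o B) \<noteq> {}"
  proof (intro allI impI)
    fix t and B :: "'a set" assume B: "bohr_set B"
    have "t \<in> t +o B" using zero_in_bohr_set[OF B] by (force simp: elt_set_plus_def)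
    then show "S \<inter> (t +o B) \<noteq> {}"
      using S openin_bohr_translate[OF B] unfolding bohr_dense_def
      by (metis UNIV_I disjoint_iff in_closure_of)
  qed
next
  assume S: "\<forall>t B. bohr_set B \<longrightarrow> S \<inter> (t +o B) \<noteq> {}"
  have "bohr_set (UNIV :: 'a set)"
    unfolding bohr_set_def by (intro exI[of _ "0::nat"] exI[of _ undefined] exI[of _ 1]) auto
  then have "openin bohr_topology (UNIV :: 'a set)"
    unfolding openin_bohr_topology bohr_neighborhood_def by blast
  then have top: "topspace bohr_topology = (UNIV :: 'a set)"
    using openin_subset by blast
  show "bohr_dense S"
    unfolding bohr_dense_def closure_of_def top
  proof safe
    fix x :: 'a and T assume "x \<in> T" "openin bohr_topology T"
    then obtain B where "bohr_set B" "x +o B \<subseteq> T"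
      unfolding openin_bohr_topology bohr_neighborhood_def by blast
    then show "\<exists>y\<in>S. y \<in> T" using S by blast
  qed
qed

end

theory Submission
  imports Defs
begin

text \<open>
  Everything rests on a function \<open>f\<close> on the group, a sum of plurality votes with values in
  \<open>\<F>\<^sub>p\<close>, that a Bohr dense set \<open>S\<close> of translations increases by exactly \<open>1\<close> at every point
  where the votes are decided by a sufficient margin. Given such an \<open>f\<close>, let \<open>E \<subseteq> \<F>\<^sub>p\<close> contain no
  two consecutive residues and let \<open>A\<close> be the set of points with \<open>f \<in> E\<close> at which the margins are
  large enough for two successive translations. If \<open>S + A\<close> were piecewise Bohr with Bohr set
  \<open>B'\<close>, pick \<open>s \<in> S \<inter> B'\<close>; then \<open>S + A\<close> would contain some \<open>t\<close> together with \<open>t + s\<close>. But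
  \<open>f = 1 + e\<close> at \<open>t\<close> and \<open>f = 1 + e'\<close> at \<open>t + s\<close> with \<open>e, e' \<in> E\<close>, whereas
  \<open>f (t + s) = f t + 1\<close>, so \<open>e' = e + 1\<close> (\<open>sumset_not_piecewise_bohr\<close>). The largest \<open>E\<close> without
  consecutive residues has \<open>(p - 1) / 2\<close> elements, and \<open>f\<close> is equidistributed because it
  intertwines a translation with adding \<open>1\<close>; this gives the density \<open>1/2 - 1/(2p)\<close>, up to the
  points with a narrow vote.

  On a single block \<open>I\<close> of coordinates let \<open>f\<close> be the most frequent coordinate. Adding the all-one
  vector increases it by \<open>1\<close>, and so does adding any vector that equals \<open>1\<close> on all but \<open>\<kappa>\<close> places
  of \<open>I\<close>, provided that the winner leads by more than \<open>2 \<kappa>\<close>. The counts of two values differ by a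
  lazy random walk, which is spread out, so for a long block a narrow lead is rare
  (\<open>leads_generic\<close>).

  Elements near the all-one vector on one block need not meet a prescribed coset of a
  finite-index subgroup \<open>H\<close>, but for \<open>\<kappa>\<close> large in terms of the index of \<open>H\<close> some of them
  lie in \<open>H\<close> itself (\<open>near_one_in_kernel\<close>). Hence if \<open>y\<^sub>n\<close> runs through the group, with every element
  occurring together with arbitrarily large \<open>\<kappa>\<^sub>n\<close>, then the translations \<open>y\<^sub>n + z\<close>, \<open>z\<close> near the
  all-one vector on the block \<open>I\<^sub>n\<close>, form a Bohr dense set (\<open>bohr_dense_steps\<close>). The unwanted effect
  of \<open>y\<^sub>n\<close> on the blocks below \<open>I\<^sub>n\<close> is undone by the definition of \<open>f\<close>: the leader \<open>a\<close> on \<open>I\<^sub>n\<close>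
  is read first, and the lower blocks are read from \<open>x - a y\<^sub>n\<close>. A translation by \<open>y\<^sub>n + z\<close> turns
  \<open>a\<close> into \<open>a + 1\<close>, so that \<open>x - a y\<^sub>n\<close> changes by \<open>z\<close> alone, which is invisible below \<open>I\<^sub>n\<close>; thus
  the sum \<open>f\<close> of all the leaders increases by exactly \<open>1\<close> (\<open>total_add_step\<close>).
\<close>

section \<open>Finite windows of the group\<close>

abbreviation lookup :: "('a \<Rightarrow>\<^sub>0 'b::zero) \<Rightarrow> 'a \<Rightarrow> 'b" where
  "lookup \<equiv> Poly_Mapping.lookup"

abbreviation keys :: "('a \<Rightarrow>\<^sub>0 'b::zero) \<Rightarrow> 'a set" where
  "keys \<equiv> Poly_Mapping.keys"

definition scale :: "'p::nontriv mod_ring \<Rightarrow> 'p Fp_omega \<Rightarrow> 'p Fp_omega" where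
  "scale c x = Poly_Mapping.map ((*) c) x"

lemma lookup_scale [simp]: "lookup (scale c x) i = c * lookup x i"
  unfolding scale_def by (simp add: Poly_Mapping.map.rep_eq when_def)

definition ones :: "nat set \<Rightarrow> 'p::nontriv Fp_omega" where
  "ones I = (\<Sum>i\<in>I. Poly_Mapping.single i 1)"

lemma lookup_ones: "finite I \<Longrightarrow> lookup (ones I) i = (if i \<in> I then 1 else 0)"
  unfolding ones_def lookup_sum lookup_single by (simp add: when_def sum.delta)

lemma ones_Un: "finite I \<Longrightarrow> finite J \<Longrightarrow> I \<inter> J = {} \<Longrightarrow> ones (I \<union> J) = ones I + ones J"
  by (intro poly_mapping_eqI) (auto simp: lookup_add lookup_ones)

definition vecs :: "nat \<Rightarrow> 'p::nontriv Fp_omega set" where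
  "vecs B = {x. keys x \<subseteq> {..<B}}"

lemma in_vecs: "x \<in> vecs B \<longleftrightarrow> (\<forall>i\<ge>B. lookup x i = 0)"
  unfolding vecs_def by (auto simp: in_keys_iff subset_iff) (meson not_le)

lemma vecs_0 [simp]: "0 \<in> vecs B"
  and vecs_add [simp]: "x \<in> vecs B \<Longrightarrow> y \<in> vecs B \<Longrightarrow> x + y \<in> vecs B"
  and vecs_diff [simp]: "x \<in> vecs B \<Longrightarrow> y \<in> vecs B \<Longrightarrow> x - y \<in> vecs B"
  and vecs_scale [simp]: "x \<in> vecs B \<Longrightarrow> scale c x \<in> vecs B"
  by (simp_all add: in_vecs lookup_add lookup_minus)

lemma vecs_mono: "B \<le> C \<Longrightarrow> vecs B \<subseteq> vecs C"
  by (auto simp: in_vecs)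

lemma finite_vecs [simp]: "finite (vecs B :: 'p::nontriv Fp_omega set)"
proof (rule inj_on_finite)
  show "inj_on (\<lambda>x. restrict (lookup x) {..<B}) (vecs B :: 'p Fp_omega set)"
  proof (rule inj_onI, rule poly_mapping_eqI)
    fix x y :: "'p Fp_omega" and i
    assume "x \<in> vecs B" "y \<in> vecs B" "restrict (lookup x) {..<B} = restrict (lookup y) {..<B}"
    then show "lookup x i = lookup y i"
      by (cases "i < B") (auto simp: in_vecs dest: fun_cong[where x = i])
  qed
  show "(\<lambda>x. restrict (lookup x) {..<B}) ` vecs B \<subseteq> {..<B} \<rightarrow>\<^sub>E (UNIV :: 'p mod_ring set)"
    by (simp add: image_subset_iff restrict_PiE_iff)
  show "finite ({..<B} \<rightarrow>\<^sub>E (UNIV :: 'p mod_ring set))" by (simp add: finite_PiE)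
qed

lemma card_vecs_pos [simp]: "card (vecs B :: 'p::nontriv Fp_omega set) > 0"
  using vecs_0 finite_vecs card_gt_0_iff by blast

lemma exhaust_vecs: "\<exists>B. x \<in> vecs B"
proof -
  have "x \<in> vecs (Suc (Max (insert 0 (keys x))))"
    unfolding vecs_def by (auto simp: less_Suc_eq_le)
  then show ?thesis ..
qed

lemma countable_Fp_omega: "countable (UNIV :: 'p::nontriv Fp_omega set)"
proof -
  have "(UNIV :: 'p Fp_omega set) = (\<Union>B. vecs B)" using exhaust_vecs by auto
  then show ?thesis by (metis countable_UN countable_finite finite_vecs countableI_type)
qed

lemma mod_ring_of_nat: "\<exists>m. v = (of_nat m :: 'p::nontriv mod_ring)"
proof -
  have "to_int_mod_ring v \<in> {0..<int CARD('p)}" using range_to_int_mod_ring[where ?'a = 'p] by blast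
  then have "of_nat (nat (to_int_mod_ring v)) = v" by (simp add: of_nat_of_int_mod_ring)
  then show ?thesis by metis
qed

section \<open>A lazy walk on the integers spreads out\<close>

text \<open>
  The law after \<open>n\<close> steps, started at \<open>0\<close>, of the walk that moves by \<open>1\<close> and by \<open>-1\<close> with
  probability \<open>r\<close> each and otherwise rests.
\<close>

fun walk :: "real \<Rightarrow> nat \<Rightarrow> int \<Rightarrow> real" where
  "walk r 0 j = (if j = 0 then 1 else 0)"
| "walk r (Suc n) j = (1 - 2 * r) * walk r n j + r * (walk r n (j - 1) + walk r n (j + 1))"

lemma walk_nonneg:
  assumes "0 \<le> r" "r \<le> 1/3"
  shows "walk r n j \<ge> 0"
  using assms by (induction n arbitrary: j) (auto intro!: add_nonneg_nonneg mult_nonneg_nonneg)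

lemma walk_symmetric: "walk r n (- j) = walk r n j"
proof (induction n arbitrary: j)
  case (Suc n)
  have "- j - 1 = - (j + 1)" "- j + 1 = - (j - 1)" by simp_all
  then show ?case by (simp only: walk.simps Suc add.commute)
qed auto

text \<open>
  The step law is symmetric and, for \<open>r \<le> 1/3\<close>, itself unimodal, and convolution preserves
  this. At \<open>j = 0\<close> the symmetry turns the increment of the next law into a combination of
  increments of the present one with the coefficients \<open>1 - 3 r\<close> and \<open>r\<close>, which is where the bound
  on \<open>r\<close> enters.
\<close>

lemma walk_unimodal:
  assumes "0 \<le> r" "r \<le> 1/3" "0 \<le> j"
  shows "walk r n (j + 1) \<le> walk r n j"
  using \<open>0 \<le> j\<close>
proof (induction n arbitrary: j)
  case (Suc n)
  let ?u = "walk r n"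
  have diff: "walk r (Suc n) j - walk r (Suc n) (j + 1)
      = (1 - 2 * r) * (?u j - ?u (j + 1)) + r * (?u (j - 1) - ?u j) + r * (?u (j + 1) - ?u (j + 2))"
    by (simp add: algebra_simps)
  have 1: "?u j - ?u (j + 1) \<ge> 0" and 2: "?u (j + 1) - ?u (j + 2) \<ge> 0"
    using Suc.IH[of j] Suc.IH[of "j + 1"] Suc.prems by (simp_all add: add.assoc)
  show ?case
  proof (cases "j = 0")
    case True
    have "?u (j - 1) = ?u (j + 1)"
      using walk_symmetric[of r n 1] True by simp
    then have "walk r (Suc n) j - walk r (Suc n) (j + 1)
      = (1 - 3 * r) * (?u j - ?u (j + 1)) + r * (?u (j + 1) - ?u (j + 2))"
      using diff by (simp add: algebra_simps)
    also have "\<dots> \<ge> 0"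
      using 1 2 assms by (intro add_nonneg_nonneg mult_nonneg_nonneg) auto
    finally show ?thesis by simp
  next
    case False
    then have 3: "?u (j - 1) - ?u j \<ge> 0"
      using Suc.IH[of "j - 1"] Suc.prems by simp
    have "walk r (Suc n) j - walk r (Suc n) (j + 1) \<ge> 0"
      unfolding diff using 1 2 3 assms by (intro add_nonneg_nonneg mult_nonneg_nonneg) auto
    then show ?thesis by simp
  qed
qed auto

lemma walk_le_center:
  assumes "0 \<le> r" "r \<le> 1/3"
  shows "walk r n j \<le> walk r n 0"
proof -
  have *: "walk r n (int m) \<le> walk r n 0" for m
  proof (induction m)
    case (Suc m)
    show ?case using walk_unimodal[OF assms, of "int m" n] Suc by (simp add: add.commute)
  qed simp
  show ?thesis
    using *[of "nat \<bar>j\<bar>"] walk_symmetric[of r n j] by (cases "j \<ge> 0") auto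
qed

lemma walk_center_decreasing:
  assumes "0 \<le> r" "r \<le> 1/3"
  shows "walk r (Suc n) 0 \<le> walk r n 0"
proof -
  have "walk r (Suc n) 0 \<le> (1 - 2 * r) * walk r n 0 + r * (walk r n 0 + walk r n 0)"
    unfolding walk.simps
    using assms walk_le_center[OF assms, of n] by (intro add_mono mult_left_mono) auto
  then show ?thesis by (simp add: algebra_simps)
qed

lemma walk_mass:
  assumes "0 \<le> r" "r \<le> 1/3" "finite J"
  shows "(\<Sum>j\<in>J. walk r n j) \<le> 1"
  using \<open>finite J\<close>
proof (induction n arbitrary: J)
  case 0
  have "(\<Sum>j\<in>J. walk r 0 j) = (if 0 \<in> J then 1 else 0)"
    using 0 by (simp add: sum.delta)
  then show ?case by simp
next
  case (Suc n)
  have "(\<Sum>j\<in>J. walk r (Suc n) j) = (1 - 2 * r) * (\<Sum>j\<in>J. walk r n j)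
      + r * ((\<Sum>j\<in>(\<lambda>j. j - 1) ` J. walk r n j) + (\<Sum>j\<in>(\<lambda>j. j + 1) ` J. walk r n j))"
    by (simp add: sum.distrib sum.reindex inj_on_def flip: sum_distrib_left)
  also have "\<dots> \<le> (1 - 2 * r) * 1 + r * (1 + 1)"
    using Suc assms by (intro add_mono mult_left_mono) auto
  finally show ?case by simp
qed

text \<open>
  The maximal value sits at \<open>0\<close> and decreases in \<open>n\<close>, so it has a limit \<open>l\<close>. Solving the recursion
  for \<open>walk r n (j + 1)\<close> propagates this limit to every site: each value tends to the same \<open>l\<close>. Since
  the total mass is at most \<open>1\<close>, any number \<open>m\<close> of sites gives \<open>m l \<le> 1\<close>, whence \<open>l = 0\<close>.
\<close>

lemma walk_center_tendsto_0:
  assumes "0 < r" "r \<le> 1/3"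
  shows "(\<lambda>n. walk r n 0) \<longlonglongrightarrow> 0"
proof -
  have r: "0 \<le> r" using assms by simp
  have "decseq (\<lambda>n. walk r n 0)"
    using walk_center_decreasing[OF r assms(2)] by (intro decseq_SucI) auto
  then obtain l where l: "(\<lambda>n. walk r n 0) \<longlonglongrightarrow> l"
    using decseq_convergent[of "\<lambda>n. walk r n 0" 0] walk_nonneg[OF r assms(2)] by metis
  have step: "(\<lambda>n. walk r n (j + 1)) \<longlonglongrightarrow> l"
    if "(\<lambda>n. walk r n j) \<longlonglongrightarrow> l" "(\<lambda>n. walk r n (j - 1)) \<longlonglongrightarrow> l" for j
  proof -
    have "walk r n (j + 1) = (walk r (Suc n) j - (1 - 2 * r) * walk r n j) / r - walk r n (j - 1)" for n
      using assms by (simp add: field_simps)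
    moreover have "(\<lambda>n. (walk r (Suc n) j - (1 - 2 * r) * walk r n j) / r - walk r n (j - 1))
        \<longlonglongrightarrow> (l - (1 - 2 * r) * l) / r - l"
      using that assms by (intro tendsto_intros LIMSEQ_Suc) auto
    moreover have "(l - (1 - 2 * r) * l) / r - l = l" using assms by (simp add: field_simps)
    ultimately show ?thesis by simp
  qed
  have one: "(\<lambda>n. walk r n 1) \<longlonglongrightarrow> l"
  proof -
    have "walk r n 1 = (walk r (Suc n) 0 - (1 - 2 * r) * walk r n 0) / (2 * r)" for n
      using assms walk_symmetric[of r n 1] by (simp add: field_simps)
    moreover have "(\<lambda>n. (walk r (Suc n) 0 - (1 - 2 * r) * walk r n 0) / (2 * r))
        \<longlonglongrightarrow> (l - (1 - 2 * r) * l) / (2 * r)"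
      using l assms by (intro tendsto_intros LIMSEQ_Suc) auto
    moreover have "(l - (1 - 2 * r) * l) / (2 * r) = l" using assms by (simp add: field_simps)
    ultimately show ?thesis by simp
  qed
  have all: "(\<lambda>n. walk r n (int m)) \<longlonglongrightarrow> l \<and> (\<lambda>n. walk r n (int m + 1)) \<longlonglongrightarrow> l" for m
  proof (induction m)
    case (Suc m)
    have "(\<lambda>n. walk r n (int m + 1 + 1)) \<longlonglongrightarrow> l" using step[of "int m + 1"] Suc by simp
    then show ?case using Suc by (simp add: add.commute add.left_commute)
  qed (use l one in auto)
  have "real m * l \<le> 1" for m
  proof (rule LIMSEQ_le_const2)
    have "(\<lambda>n. \<Sum>i<m. walk r n (int i)) \<longlonglongrightarrow> (\<Sum>i<m. l)"
      using all by (intro tendsto_sum) auto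
    then show "(\<lambda>n. \<Sum>i<m. walk r n (int i)) \<longlonglongrightarrow> real m * l" by simp
    have "(\<Sum>i<m. walk r n (int i)) \<le> 1" for n
      using walk_mass[OF r assms(2), of "int ` {..<m}" n] by (simp add: sum.reindex)
    then show "\<exists>N. \<forall>n\<ge>N. (\<Sum>i<m. walk r n (int i)) \<le> 1" by blast
  qed
  then have "l \<le> 0" by (metis not_le reals_Archimedean3)
  moreover have "l \<ge> 0" using walk_nonneg[OF r assms(2)] l LIMSEQ_le_const by blast
  ultimately show ?thesis using l by simp
qed

section \<open>The most frequent value on a set of coordinates\<close>

definition occ :: "nat set \<Rightarrow> 'p::nontriv Fp_omega \<Rightarrow> 'p mod_ring \<Rightarrow> nat" where
  "occ I x a = card {i\<in>I. lookup x i = a}"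

definition leads :: "nat \<Rightarrow> nat set \<Rightarrow> 'p::nontriv Fp_omega \<Rightarrow> 'p mod_ring \<Rightarrow> bool" where
  "leads M I x a \<longleftrightarrow> (\<forall>c. c \<noteq> a \<longrightarrow> occ I x c + M \<le> occ I x a)"

lemma card_translate_invariant:
  fixes V :: "'a::ab_group_add set"
  assumes "\<And>x. x \<in> V \<Longrightarrow> x + g \<in> V" "\<And>x. x \<in> V \<Longrightarrow> x - g \<in> V"
    and "\<And>x. x \<in> V \<Longrightarrow> P x \<longleftrightarrow> Q (x + g)"
  shows "card {x\<in>V. P x} = card {x\<in>V. Q x}"
  by (rule bij_betw_same_card[of "\<lambda>x. x + g"], rule bij_betwI[where g = "\<lambda>x. x - g"])
    (use assms in auto)

text \<open>
  Reading the coordinates in \<open>I\<close> one by one, the difference of the two counts goes up at \<open>a\<close>, down at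
  \<open>b\<close> and rests at the other \<open>p - 2\<close> values. A new coordinate is independent of the earlier ones
  because a translation along it permutes its values without touching the others.
\<close>

lemma occ_difference_distribution:
  fixes a b :: "'p::nontriv mod_ring"
  assumes ab: "a \<noteq> b" and I: "I \<subseteq> {..<B}"
  shows "real (card {x \<in> vecs B. int (occ I x a) - int (occ I x b) = j})
    = walk (1 / real CARD('p)) (card I) j * real (card (vecs B :: 'p Fp_omega set))"
proof -
  have "finite I" using I finite_subset by blast
  then show ?thesis using I
  proof (induction I arbitrary: j rule: finite_induct)
    case empty
    have "{x \<in> vecs B. int (occ {} x a) - int (occ {} x b) = j} = (if j = 0 then vecs B else {})"
      by (auto simp: occ_def)
    then show ?case by simp
  next
    case (insert k I)
    let ?V = "vecs B :: 'p Fp_omega set"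
    define X where "X I x = int (occ I x a) - int (occ I x b)" for I and x :: "'p Fp_omega"
    define p where "p = real CARD('p)"
    have p0: "p > 0" by (simp add: p_def)
    have k: "Poly_Mapping.single k c \<in> ?V" for c
      using insert.prems by (auto simp: in_vecs lookup_single when_def)
    have part: "real (card {x \<in> ?V. X I x = j \<and> lookup x k = v}) = real (card {x \<in> ?V. X I x = j}) / p" for v j
    proof -
      have same: "card {x \<in> ?V. X I x = j \<and> lookup x k = w} = card {x \<in> ?V. X I x = j \<and> lookup x k = v}" for w
      proof (rule card_translate_invariant[where g = "Poly_Mapping.single k (v - w)"])
        fix x :: "'p Fp_omega"
        have "lookup (x + Poly_Mapping.single k (v - w)) i = lookup x i" if "i \<in> I" for i
          using that insert.hyps by (auto simp: lookup_add lookup_single when_def)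
        then have "X I (x + Poly_Mapping.single k (v - w)) = X I x"
          by (simp add: X_def occ_def cong: conj_cong)
        then show "(X I x = j \<and> lookup x k = w) \<longleftrightarrow> (X I (x + Poly_Mapping.single k (v - w)) = j
            \<and> lookup (x + Poly_Mapping.single k (v - w)) k = v)"
          by (auto simp: lookup_add algebra_simps)
      qed (use k in auto)
      have U: "{x \<in> ?V. X I x = j} = (\<Union>w. {x \<in> ?V. X I x = j \<and> lookup x k = w})" by auto
      have "card {x \<in> ?V. X I x = j} = (\<Sum>w\<in>UNIV. card {x \<in> ?V. X I x = j \<and> lookup x k = w})"
        by (subst U, subst card_UN_disjoint[symmetric]) auto
      also have "\<dots> = (\<Sum>w\<in>(UNIV :: 'p mod_ring set). card {x \<in> ?V. X I x = j \<and> lookup x k = v})"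
        by (intro sum.cong refl same)
      finally show ?thesis using p0 by (simp add: p_def)
    qed
    have occ: "occ (insert k I) x c = (if lookup x k = c then 1 else 0) + occ I x c" for x :: "'p Fp_omega" and c
    proof -
      have "{i \<in> insert k I. lookup x i = c} = (if lookup x k = c then {k} else {}) \<union> {i \<in> I. lookup x i = c}" by auto
      then show ?thesis using insert.hyps by (auto simp: occ_def)
    qed
    have X: "X (insert k I) x = (if lookup x k = a then 1 else if lookup x k = b then -1 else 0) + X I x" for x
      using ab by (auto simp: X_def occ)
    define d where "d v = (if v = a then 1 else if v = b then -1 else (0::int))" for v :: "'p mod_ring"
    have "{x \<in> ?V. X (insert k I) x = j} = (\<Union>v. {x \<in> ?V. X I x = j - d v \<and> lookup x k = v})"
      by (auto simp: X d_def)
    then have "real (card {x \<in> ?V. X (insert k I) x = j})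
        = (\<Sum>v\<in>UNIV. real (card {x \<in> ?V. X I x = j - d v \<and> lookup x k = v}))"
      by (subst of_nat_sum[symmetric], subst card_UN_disjoint[symmetric]) auto
    also have "\<dots> = (\<Sum>v\<in>UNIV. real (card {x \<in> ?V. X I x = j - d v})) / p"
      by (simp add: part sum_divide_distrib)
    also have "\<dots> = (\<Sum>v\<in>UNIV. walk (1/p) (card I) (j - d v)) * real (card ?V) / p"
      using insert.IH insert.prems by (simp add: X_def p_def sum_distrib_right)
    also have "(\<Sum>v\<in>UNIV. walk (1/p) (card I) (j - d v))
        = walk (1/p) (card I) (j - 1) + (walk (1/p) (card I) (j + 1) + (p - 2) * walk (1/p) (card I) j)"
    proof -
      have U: "(UNIV :: 'p mod_ring set) = insert a (insert b (- {a, b}))" by auto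
      have "card {a, b} \<le> CARD('p mod_ring)" by (intro card_mono) auto
      then have "real (card (- {a, b})) = p - 2"
        using ab by (simp add: Compl_eq_Diff_UNIV card_Diff_subset p_def of_nat_diff)
      then show ?thesis unfolding U using ab by (simp add: d_def)
    qed
    also have "\<dots> * real (card ?V) / p = walk (1/p) (card (insert k I)) j * real (card ?V)"
      using insert.hyps p0 by (simp add: field_simps)
    finally show ?case by (simp add: X_def p_def)
  qed
qed

lemma ex_leads_of_gaps:
  fixes x :: "'p::nontriv Fp_omega"
  assumes "\<And>a b. a \<noteq> b \<Longrightarrow> \<bar>int (occ I x a) - int (occ I x b)\<bar> \<ge> int M"
  shows "\<exists>a. leads M I x a"
proof -
  obtain a where a: "\<And>c. occ I x c \<le> occ I x a"
  proof -
    have "Max (range (occ I x)) \<in> range (occ I x)" by (intro Max_in) auto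
    then obtain a where "occ I x a = Max (range (occ I x))" by (metis imageE)
    then show ?thesis using that[of a] by simp
  qed
  have "leads M I x a"
    unfolding leads_def
  proof (intro allI impI)
    fix c assume "c \<noteq> a"
    then show "occ I x c + M \<le> occ I x a" using assms[of c a] a[of c] by linarith
  qed
  then show ?thesis ..
qed

text \<open>
  A union bound over the pairs of values and the differences of absolute value at most \<open>M\<close>. Their
  number does not depend on the block, while each difference has probability at most
  \<open>walk (1/p) n 0\<close>, with \<open>n\<close> the length of the block.
\<close>

lemma leads_generic:
  assumes "CARD('p::nontriv) \<ge> 3" "\<delta> > 0"
  shows "\<exists>L. \<forall>I B. I \<subseteq> {..<B} \<and> card I \<ge> L \<longrightarrow>
    real (card {x \<in> vecs B. \<not> (\<exists>a. leads M I (x :: 'p Fp_omega) a)}) \<le> \<delta> * real (card (vecs B :: 'p Fp_omega set))"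
proof -
  define r where "r = 1 / real CARD('p)"
  have r: "0 < r" "0 \<le> r" "r \<le> 1/3" using assms by (auto simp: r_def field_simps)
  let ?P = "{(a, b). a \<noteq> b} :: ('p mod_ring \<times> 'p mod_ring) set"
  let ?J = "{- int M..int M}"
  define K where "K = real (card (?P \<times> ?J)) + 1"
  have K: "K > 0" by (simp add: K_def add_nonneg_pos)
  then have "\<delta> / K > 0" using assms by simp
  then obtain L where L: "\<And>n. n \<ge> L \<Longrightarrow> walk r n 0 < \<delta> / K"
    using order_tendstoD(2)[OF walk_center_tendsto_0[OF r(1,3)]] unfolding eventually_sequentially by blast
  show ?thesis
  proof (intro exI allI impI)
    fix I :: "nat set" and B :: nat assume I: "I \<subseteq> {..<B} \<and> card I \<ge> L"
    let ?V = "vecs B :: 'p Fp_omega set"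
    define D where "D = (\<lambda>((a, b), j). {x \<in> ?V. int (occ I x a) - int (occ I x b) = j})"
    have "{x \<in> ?V. \<not> (\<exists>a. leads M I x a)} \<subseteq> \<Union> (D ` (?P \<times> ?J))"
    proof
      fix x assume x: "x \<in> {x \<in> ?V. \<not> (\<exists>a. leads M I x a)}"
      then have "\<not> (\<forall>a b. a \<noteq> b \<longrightarrow> int M \<le> \<bar>int (occ I x a) - int (occ I x b)\<bar>)"
        using ex_leads_of_gaps[where I = I and x = x and M = M] by blast
      then obtain a b where "a \<noteq> b" "\<bar>int (occ I x a) - int (occ I x b)\<bar> < int M"
        by (auto simp: not_le)
      then show "x \<in> \<Union> (D ` (?P \<times> ?J))"
        using x by (intro UN_I[of "((a, b), int (occ I x a) - int (occ I x b))"]) (auto simp: D_def)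
    qed
    then have "card {x \<in> ?V. \<not> (\<exists>a. leads M I x a)} \<le> card (\<Union> (D ` (?P \<times> ?J)))"
      by (intro card_mono) (auto simp: D_def)
    also have "\<dots> \<le> (\<Sum>q\<in>?P \<times> ?J. card (D q))" by (rule card_UN_le) simp
    finally have "real (card {x \<in> ?V. \<not> (\<exists>a. leads M I x a)}) \<le> (\<Sum>q\<in>?P \<times> ?J. real (card (D q)))"
      unfolding of_nat_sum[symmetric] by (simp only: of_nat_le_iff)
    also have "\<dots> \<le> (\<Sum>q\<in>?P \<times> ?J. \<delta> / K * real (card ?V))"
    proof (rule sum_mono)
      fix q assume "q \<in> ?P \<times> ?J"
      then obtain a b j where q: "q = ((a, b), j)" "a \<noteq> b" by auto
      have "real (card (D q)) = walk r (card I) j * real (card ?V)"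
        using occ_difference_distribution[of a b I B j] q I by (simp add: D_def r_def)
      also have "\<dots> \<le> \<delta> / K * real (card ?V)"
        using walk_le_center[OF r(2,3), of "card I" j] L[of "card I"] I by (intro mult_right_mono) auto
      finally show "real (card (D q)) \<le> \<delta> / K * real (card ?V)" .
    qed
    also have "\<dots> = (K - 1) / K * (\<delta> * real (card ?V))" by (simp add: K_def)
    also have "\<dots> \<le> 1 * (\<delta> * real (card ?V))"
      using K assms by (intro mult_right_mono) (auto simp: field_simps)
    finally show "real (card {x \<in> ?V. \<not> (\<exists>a. leads M I x a)}) \<le> \<delta> * real (card ?V)" by simp
  qed
qed

lemma occ_cong: "(\<And>i. i \<in> I \<Longrightarrow> lookup x i = lookup x' i) \<Longrightarrow> occ I x = occ I x'"
  by (auto simp: occ_def intro!: ext arg_cong[where f = card])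

text \<open>
  In case of a tie the value is unspecified. Unwinding a block by its leader is still a bijection
  then, because the value depends on the coordinates in \<open>I\<close> alone.
\<close>

definition leader :: "nat set \<Rightarrow> 'p::nontriv Fp_omega \<Rightarrow> 'p mod_ring" where
  "leader I x = (THE a. leads 1 I x a)"

lemma leader_eq:
  assumes "leads M I x a" "M \<ge> 1"
  shows "leader I x = a"
  unfolding leader_def
proof (rule the_equality)
  show "leads 1 I x a" using assms unfolding leads_def by force
  fix c assume c: "leads 1 I x c"
  show "c = a"
  proof (rule ccontr)
    assume "c \<noteq> a"
    then have "occ I x c + M \<le> occ I x a" "occ I x a + 1 \<le> occ I x c"
      using assms c unfolding leads_def by auto
    then show False by simp
  qed
qed

lemma leads_zero:
  assumes "\<And>i. i \<in> I \<Longrightarrow> lookup x i = 0" "finite I" "M \<le> card I"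
  shows "leads M I x 0"
proof -
  have "{i \<in> I. lookup x i = 0} = I" using assms by auto
  then have "occ I x 0 = card I" by (simp add: occ_def)
  moreover have "occ I x c = 0" if "c \<noteq> 0" for c
  proof -
    have "{i \<in> I. lookup x i = c} = {}" using assms that by auto
    then show ?thesis by (simp only: occ_def card.empty)
  qed
  ultimately show ?thesis using assms by (simp add: leads_def)
qed

text \<open>
  Adding the constant \<open>1\<close> shifts all the counts along, and each of the at most \<open>\<kappa>\<close> exceptional
  coordinates can raise a count or lower one by \<open>1\<close>. So a gap between two counts shrinks by at
  most \<open>2 \<kappa>\<close>.
\<close>

lemma leads_add_near_one:
  assumes x: "leads M I x a" and I: "finite I"
    and s: "card {i\<in>I. lookup s i \<noteq> 1} \<le> \<kappa>" and M: "2 * \<kappa> \<le> M"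
  shows "leads (M - 2 * \<kappa>) I (x + s) (a + 1)"
  unfolding leads_def
proof (intro allI impI)
  let ?D = "{i\<in>I. lookup s i \<noteq> 1}"
  fix c assume "c \<noteq> a + 1"
  then have "c - 1 \<noteq> a" by (metis diff_add_cancel)
  then have 1: "occ I x (c - 1) + M \<le> occ I x a" using x by (simp add: leads_def)
  have "card {i\<in>I. lookup (x + s) i = c} \<le> card ({i\<in>I. lookup x i = c - 1} \<union> ?D)"
    using I by (intro card_mono) (auto simp: lookup_add)
  also have "\<dots> \<le> occ I x (c - 1) + \<kappa>"
    using card_Un_le[of "{i\<in>I. lookup x i = c - 1}" ?D] s by (simp add: occ_def)
  finally have 2: "occ I (x + s) c \<le> occ I x (c - 1) + \<kappa>" by (simp add: occ_def)
  have "card {i\<in>I. lookup x i = a} \<le> card ({i\<in>I. lookup (x + s) i = a + 1} \<union> ?D)"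
    using I by (intro card_mono) (auto simp: lookup_add)
  also have "\<dots> \<le> occ I (x + s) (a + 1) + \<kappa>"
    using card_Un_le[of "{i\<in>I. lookup (x + s) i = a + 1}" ?D] s by (simp add: occ_def)
  finally have 3: "occ I x a \<le> occ I (x + s) (a + 1) + \<kappa>" by (simp add: occ_def)
  show "occ I (x + s) c + (M - 2 * \<kappa>) \<le> occ I (x + s) (a + 1)"
    using 1 2 3 M by linarith
qed

section \<open>Bounded deviations inside a finite-index subgroup\<close>

lemma character_scale:
  assumes "circle_character \<xi>"
  shows "\<xi> (scale (of_nat m) g) = \<xi> g ^ m"
proof (induction m)
  case 0
  have "scale 0 g = 0" by (intro poly_mapping_eqI) simp
  then show ?case using circle_character_zero[OF assms] by simp
next
  case (Suc m)
  have "scale (of_nat (Suc m)) g = g + scale (of_nat m) g"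
    by (intro poly_mapping_eqI) (simp add: lookup_add algebra_simps)
  then show ?case using Suc assms by (simp add: circle_character_def)
qed

lemma character_root_of_unity:
  fixes \<xi> :: "'p::nontriv Fp_omega \<Rightarrow> complex"
  assumes "circle_character \<xi>"
  shows "\<xi> g ^ CARD('p) = 1"
proof -
  have "scale (of_nat CARD('p)) g = 0" by (intro poly_mapping_eqI) simp
  then show ?thesis
    using character_scale[OF assms, of "CARD('p)" g] circle_character_zero[OF assms] by simp
qed

text \<open>
  Among the vectors supported in \<open>I\<close> on which all the characters are \<open>1\<close>, take one with the fewest
  coordinates different from \<open>1\<close>. The characters take only finitely many joint values. If there were
  more exceptional coordinates than joint values, then by the pigeonhole principle the indicator
  vectors of two initial segments of the exceptional set would share their joint value, and the
  indicator vector \<open>w\<close> of the difference of the segments would be in the kernel. A multiple of \<open>w\<close>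
  added to the vector makes one exceptional coordinate equal to \<open>1\<close> and leaves those outside the
  exceptional set alone, against minimality. The bound is thus uniform in \<open>I\<close>.
\<close>

lemma near_one_in_kernel:
  fixes \<xi> :: "nat \<Rightarrow> 'p::nontriv Fp_omega \<Rightarrow> complex"
  assumes "\<forall>j\<in>{1..k}. circle_character (\<xi> j)"
  shows "\<exists>N. \<forall>I. finite I \<longrightarrow> (\<exists>z. (\<forall>i. i \<notin> I \<longrightarrow> lookup z i = 0)
    \<and> card {i\<in>I. lookup z i \<noteq> 1} \<le> N \<and> (\<forall>j\<in>{1..k}. \<xi> j z = 1))"
proof -
  have char: "circle_character (\<xi> j)" if "j \<in> {1..k}" for j using assms that by blast
  define \<Phi> where "\<Phi> g = restrict (\<lambda>j. \<xi> j g) {1..k}" for g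
  have "range \<Phi> \<subseteq> {1..k} \<rightarrow>\<^sub>E {w. w ^ CARD('p) = 1}"
    using character_root_of_unity[OF char] by (auto simp: \<Phi>_def)
  moreover have "finite ({1..k} \<rightarrow>\<^sub>E {w :: complex. w ^ CARD('p) = 1})"
    by (intro finite_PiE finite_roots_unity) auto
  ultimately have fin: "finite (range \<Phi>)" by (rule finite_subset)
  show ?thesis
  proof (rule exI[of _ "card (range \<Phi>)"], intro allI impI)
    fix I :: "nat set" assume I: "finite I"
    define admissible where "admissible z \<longleftrightarrow> (\<forall>i. i \<notin> I \<longrightarrow> lookup z i = 0) \<and> (\<forall>j\<in>{1..k}. \<xi> j z = 1)" for z
    define exceptions where "exceptions z = {i\<in>I. lookup z i \<noteq> 1}" for z :: "'p Fp_omega"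
    have "admissible 0" using char by (auto simp: admissible_def circle_character_zero)
    then obtain z where z: "admissible z" and least: "\<And>z'. admissible z' \<Longrightarrow> card (exceptions z) \<le> card (exceptions z')"
      using ex_has_least_nat[of admissible 0 "\<lambda>z. card (exceptions z)"] by blast
    have "card (exceptions z) \<le> card (range \<Phi>)"
    proof (rule ccontr)
      assume "\<not> card (exceptions z) \<le> card (range \<Phi>)"
      then have many: "card (range \<Phi>) < card (exceptions z)" by simp
      have finJ: "finite (exceptions z)" using I by (simp add: exceptions_def)
      obtain e where e: "bij_betw e {0..<card (exceptions z)} (exceptions z)"
        using ex_bij_betw_nat_finite[OF finJ] by blast
      define \<sigma> where "\<sigma> l = (ones (e ` {0..<l}) :: 'p Fp_omega)" for l
      have "card ((\<lambda>l. \<Phi> (\<sigma> l)) ` {0..<card (exceptions z)}) \<le> card (range \<Phi>)"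
        using fin by (intro card_mono) auto
      then have "\<not> inj_on (\<lambda>l. \<Phi> (\<sigma> l)) {0..<card (exceptions z)}"
        using many by (intro pigeonhole) simp
      then obtain l l' where l: "l < l'" "l' < card (exceptions z)" "\<Phi> (\<sigma> l) = \<Phi> (\<sigma> l')"
        unfolding inj_on_def by (metis atLeastLessThan_iff nat_neq_iff)
      define w where "w = (ones (e ` {l..<l'}) :: 'p Fp_omega)"
      have "inj_on e {0..<card (exceptions z)}" using e by (simp add: bij_betw_def)
      then have "e ` {0..<l} \<inter> e ` {l..<l'} = {}"
        using l by (subst inj_on_image_Int[symmetric, of e "{0..<card (exceptions z)}"]) auto
      moreover have "{0..<l'} = {0..<l} \<union> {l..<l'}" using l by auto
      ultimately have "\<sigma> l' = \<sigma> l + w"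
        unfolding \<sigma>_def w_def by (simp add: image_Un ones_Un)
      have w1: "\<xi> j w = 1" if j: "j \<in> {1..k}" for j
      proof -
        have "\<xi> j (\<sigma> l) = \<xi> j (\<sigma> l')" using fun_cong[OF l(3), of j] j by (simp add: \<Phi>_def)
        moreover have "\<xi> j (\<sigma> l') = \<xi> j (\<sigma> l) * \<xi> j w" "norm (\<xi> j (\<sigma> l)) = 1"
          using char[OF j] \<open>\<sigma> l' = \<sigma> l + w\<close> by (auto simp: circle_character_def)
        ultimately show ?thesis by (metis mult_cancel_left2 norm_zero zero_neq_one)
      qed
      have el: "e ` {l..<l'} \<subseteq> exceptions z" "e l \<in> e ` {l..<l'}"
        using e l by (auto simp: bij_betw_def)
      \<comment> \<open>The multiple of \<open>w\<close> that turns the coordinate \<open>e l\<close> into \<open>1\<close>.\<close>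
      obtain m where m: "1 - lookup z (e l) = of_nat m" using mod_ring_of_nat by blast
      define z' where "z' = z + scale (of_nat m) w"
      have lz': "lookup z' i = lookup z i + (if i \<in> e ` {l..<l'} then of_nat m else 0)" for i
        by (simp add: z'_def w_def lookup_add lookup_ones)
      have "admissible z'"
        unfolding admissible_def
      proof (intro conjI allI impI ballI)
        fix i assume "i \<notin> I"
        then show "lookup z' i = 0" using z el unfolding lz' by (auto simp: admissible_def exceptions_def)
      next
        fix j assume j: "j \<in> {1..k}"
        then have "\<xi> j z' = \<xi> j z * \<xi> j w ^ m"
          using char[OF j] character_scale[OF char[OF j]] by (simp add: z'_def circle_character_def)
        then show "\<xi> j z' = 1" using z w1 j by (simp add: admissible_def)
      qed
      moreover have "exceptions z' \<subset> exceptions z"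
      proof
        show "exceptions z' \<subseteq> exceptions z"
          using el by (auto simp: exceptions_def lz' split: if_splits)
        have "lookup z' (e l) = 1" using el by (simp add: lz' flip: m)
        then have "e l \<notin> exceptions z'" by (simp add: exceptions_def)
        then show "exceptions z' \<noteq> exceptions z" using el by blast
      qed
      ultimately show False using least[of z'] psubset_card_mono[OF finJ] by (meson not_le)
    qed
    then show "\<exists>z. (\<forall>i. i \<notin> I \<longrightarrow> lookup z i = 0) \<and> card {i\<in>I. lookup z i \<noteq> 1} \<le> card (range \<Phi>)
        \<and> (\<forall>j\<in>{1..k}. \<xi> j z = 1)"
      using z unfolding admissible_def exceptions_def by blast
  qed
qed

section \<open>Summing leaders along a tower of blocks\<close>

text \<open>
  Every \<open>y n\<close> is supported below the \<open>n\<close>-th block \<open>{b n..<b (Suc n)}\<close>. The coordinates below \<open>b 0\<close>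
  belong to no block.
\<close>

locale block_tower =
  fixes b :: "nat \<Rightarrow> nat" and y :: "nat \<Rightarrow> 'p::nontriv Fp_omega"
  assumes b_less_Suc: "b n < b (Suc n)"
    and y_below: "y n \<in> vecs (b n)"
begin

abbreviation block :: "nat \<Rightarrow> nat set" where
  "block n \<equiv> {b n..<b (Suc n)}"

lemma b_mono: "i \<le> j \<Longrightarrow> b i \<le> b j"
  by (rule lift_Suc_mono_le[of b]) (simp_all add: less_imp_le b_less_Suc)

lemma le_b: "n \<le> b n"
proof (induction n)
  case (Suc n)
  then show ?case using b_less_Suc[of n] by simp
qed simp

definition unwind :: "nat \<Rightarrow> 'p Fp_omega \<Rightarrow> 'p Fp_omega" where
  "unwind n x = x - scale (leader (block n) x) (y n)"

text \<open>
  The blocks are read from the top down: \<open>total n\<close> adds the leaders on the blocks below \<open>n\<close>, each one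
  read after the blocks above it have been unwound. The margins \<open>\<mu>\<close> that \<open>good\<close> asks for are those
  met along the same descent.
\<close>

primrec total :: "nat \<Rightarrow> 'p Fp_omega \<Rightarrow> 'p mod_ring" where
  "total 0 x = 0"
| "total (Suc n) x = leader (block n) x + total n (unwind n x)"

primrec good :: "nat \<Rightarrow> (nat \<Rightarrow> nat) \<Rightarrow> 'p Fp_omega \<Rightarrow> bool" where
  "good 0 \<mu> x = True"
| "good (Suc n) \<mu> x = ((\<exists>a. leads (\<mu> n) (block n) x a) \<and> good n \<mu> (unwind n x))"

lemma y_eq_0: "b n \<le> i \<Longrightarrow> lookup (y n) i = 0"
  using y_below[of n] by (simp add: in_vecs)

lemma leader_block_cong:
  assumes "\<And>i. i \<in> block n \<Longrightarrow> lookup x i = lookup x' i"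
  shows "leader (block n) x = leader (block n) x'" "leads M (block n) x = leads M (block n) x'"
  using occ_cong[of "block n" x x'] assms by (auto simp: leader_def leads_def fun_eq_iff)

lemma total_good_cong:
  assumes "\<And>i. i < b n \<Longrightarrow> lookup x i = lookup x' i"
  shows "total n x = total n x' \<and> good n \<mu> x = good n \<mu> x'"
  using assms
proof (induction n arbitrary: x x')
  case (Suc n)
  have eq: "leader (block n) x = leader (block n) x'" "leads M (block n) x = leads M (block n) x'" for M
    using leader_block_cong[of n x x'] Suc.prems by auto
  have "total n (unwind n x) = total n (unwind n x') \<and> good n \<mu> (unwind n x) = good n \<mu> (unwind n x')"
    using Suc.prems b_less_Suc[of n] by (intro Suc.IH) (auto simp: unwind_def lookup_minus eq)
  then show ?case by (simp add: eq)
qed simp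

lemma good_mono:
  assumes "good n \<mu> x" "\<And>i. i < n \<Longrightarrow> \<nu> i \<le> \<mu> i"
  shows "good n \<nu> x"
  using assms
proof (induction n arbitrary: x)
  case (Suc n)
  have "leads (\<nu> n) (block n) x a" if "leads (\<mu> n) (block n) x a" for a
    using that Suc.prems(2)[of n] unfolding leads_def by force
  then show ?case using Suc by auto
qed simp

text \<open>
  On the blocks above the \<open>j\<close>-th the translation is invisible and commutes with unwinding. On the
  \<open>j\<close>-th block it raises the leader by \<open>1\<close>, so unwinding subtracts one more \<open>y j\<close> and cancels the one
  that was added. Only \<open>z\<close> remains, and it is supported above all the lower blocks.
\<close>

lemma total_add_step:
  assumes "j < n" and z: "\<And>i. i \<notin> block j \<Longrightarrow> lookup z i = 0"
    and near: "card {i\<in>block j. lookup z i \<noteq> 1} \<le> \<kappa>"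
    and good: "good n \<mu> x" and margin: "2 * \<kappa> < \<mu> j"
  shows "total n (x + (y j + z)) = total n x + 1 \<and> good n (\<mu>(j := \<mu> j - 2 * \<kappa>)) (x + (y j + z))"
  using \<open>j < n\<close> good
proof (induction n arbitrary: x)
  case (Suc m)
  let ?s = "y j + z"
  show ?case
  proof (cases "j = m")
    case True
    obtain a where a: "leads (\<mu> m) (block m) x a" using Suc.prems by auto
    have "{i\<in>block m. lookup ?s i \<noteq> 1} = {i\<in>block m. lookup z i \<noteq> 1}"
      using True by (auto simp: lookup_add y_eq_0)
    then have a': "leads (\<mu> m - 2 * \<kappa>) (block m) (x + ?s) (a + 1)"
      using a near margin True by (intro leads_add_near_one) auto
    have lead: "leader (block m) x = a" "leader (block m) (x + ?s) = a + 1"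
      using leader_eq[OF a] leader_eq[OF a'] margin True by auto
    have "unwind m (x + ?s) = unwind m x + z"
      unfolding unwind_def lead using True
      by (intro poly_mapping_eqI) (simp add: lookup_add lookup_minus algebra_simps)
    moreover have "total m (unwind m x + z) = total m (unwind m x) \<and> good m \<mu> (unwind m x + z) = good m \<mu> (unwind m x)"
      using z True by (intro total_good_cong) (auto simp: lookup_add)
    ultimately have "total m (unwind m (x + ?s)) = total m (unwind m x)"
        "good m \<mu> (unwind m (x + ?s))"
      using Suc.prems by auto
    moreover define \<nu> where "\<nu> = \<mu>(j := \<mu> j - 2 * \<kappa>)"
    have "good m \<nu> (unwind m (x + ?s))"
      using calculation(2) by (rule good_mono) (simp add: \<nu>_def True)
    moreover have "leads (\<nu> m) (block m) (x + ?s) (a + 1)"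
      using a' by (simp add: \<nu>_def True)
    ultimately show ?thesis unfolding \<nu>_def[symmetric] by (auto simp: lead)
  next
    case False
    then have j: "j < m" using Suc.prems by simp
    have "b j \<le> b m" "b (Suc j) \<le> b m" using b_mono j by auto
    then have "lookup ?s i = 0" if "i \<in> block m" for i
      using that z[of i] by (auto simp: lookup_add y_eq_0)
    then have lead: "leader (block m) (x + ?s) = leader (block m) x"
        "leads M (block m) (x + ?s) = leads M (block m) x" for M
      using leader_block_cong[of m "x + ?s" x] by (auto simp: lookup_add)
    have unw: "unwind m (x + ?s) = unwind m x + ?s"
      unfolding unwind_def lead by (simp add: algebra_simps)
    show ?thesis using Suc.IH[OF j, of "unwind m x"] Suc.prems False
      by (simp add: lead unw)
  qed
qed simp

text \<open>
  On a block where \<open>x\<close> vanishes the value \<open>0\<close> leads by the whole length of the block, so such a block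
  contributes nothing and is not unwound.
\<close>

lemma stable:
  assumes x: "x \<in> vecs (b N)" and "N \<le> n" and \<mu>: "\<And>m. \<mu> m \<le> b (Suc m) - b m"
  shows "total n x = total N x \<and> good n \<mu> x = good N \<mu> x"
  using \<open>N \<le> n\<close>
proof (induction n rule: dec_induct)
  case (step n)
  have 0: "lookup x i = 0" if "i \<in> block n" for i
    using that x b_mono[OF step.hyps(1)] by (auto simp: in_vecs)
  have "leads (\<mu> n) (block n) x 0" "leads 1 (block n) x 0"
    using \<mu>[of n] b_less_Suc[of n] 0 by (auto intro!: leads_zero)
  moreover from this have "unwind n x = x"
    by (intro poly_mapping_eqI) (simp add: unwind_def leader_eq lookup_minus)
  ultimately show ?case using step.IH leader_eq[of 1 "block n" x 0] by auto
qed simp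

text \<open>
  By stability the conditions are eventually constant in \<open>n\<close> if the blocks are long compared with
  \<open>\<mu>\<close>; asking for them eventually is a substitute for evaluating all infinitely many blocks.
\<close>

definition settled :: "(nat \<Rightarrow> nat) \<Rightarrow> 'p mod_ring set \<Rightarrow> 'p Fp_omega set" where
  "settled \<mu> E = {x. \<exists>N. \<forall>n\<ge>N. good n \<mu> x \<and> total n x \<in> E}"

definition steps :: "(nat \<Rightarrow> nat) \<Rightarrow> 'p Fp_omega set" where
  "steps k = {y j + z | j z. (\<forall>i. i \<notin> block j \<longrightarrow> lookup z i = 0) \<and> card {i\<in>block j. lookup z i \<noteq> 1} \<le> k j}"

section \<open>The sumset is not piecewise Bohr\<close>

text \<open>
  A translation costs \<open>2 k j\<close> of the margin, so the points must start with enough margin for each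
  translation that is applied to them in turn.
\<close>

lemma settled_add_step:
  assumes x: "x \<in> settled \<mu> E" and s: "s \<in> steps k" and margin: "\<And>j. 2 * k j < \<mu> j"
  shows "x + s \<in> settled (\<lambda>j. \<mu> j - 2 * k j) ((+) 1 ` E)"
proof -
  obtain N where N: "\<And>n. n \<ge> N \<Longrightarrow> good n \<mu> x \<and> total n x \<in> E" using x by (auto simp: settled_def)
  obtain j z where s: "s = y j + z" "\<And>i. i \<notin> block j \<Longrightarrow> lookup z i = 0"
      "card {i\<in>block j. lookup z i \<noteq> 1} \<le> k j"
    using s unfolding steps_def by blast
  have "good n (\<lambda>j. \<mu> j - 2 * k j) (x + s) \<and> total n (x + s) \<in> (+) 1 ` E" if n: "n \<ge> max N (Suc j)" for n
  proof -
    have "good n \<mu> x" "total n x \<in> E" "j < n" using N n by auto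
    then have "total n (x + s) = total n x + 1" "good n (\<mu>(j := \<mu> j - 2 * k j)) (x + s)"
      using total_add_step[of j n z "k j" \<mu> x] s margin by auto
    moreover from this(2) have "good n (\<lambda>j. \<mu> j - 2 * k j) (x + s)"
      by (rule good_mono) simp
    ultimately show ?thesis using \<open>total n x \<in> E\<close> by (simp add: add.commute)
  qed
  then show ?thesis unfolding settled_def by blast
qed

text \<open>
  The two-point set \<open>{0, s}\<close>, with \<open>s\<close> both in the Bohr set and among the translations, has no
  translate in the sumset. The margin \<open>4 k j + 1\<close> pays for the translation that leads from \<open>A\<close> into the
  sumset and for the one from \<open>t\<close> to \<open>t + s\<close>.
\<close>

lemma sumset_not_piecewise_bohr:
  assumes dense: "bohr_dense (steps k)" and E: "\<And>v. v \<in> E \<Longrightarrow> v + 1 \<notin> E"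
  shows "\<not> piecewise_bohr (steps k + settled (\<lambda>j. 4 * k j + 1) E)" (is "\<not> piecewise_bohr ?SA")
proof
  assume "piecewise_bohr ?SA"
  then obtain B where B: "bohr_set B" "\<forall>F. finite F \<and> F \<subseteq> B \<longrightarrow> (\<exists>t. t +o F \<subseteq> ?SA)"
    unfolding piecewise_bohr_def by (elim exE conjE)
  have "steps k \<inter> (0 +o B) \<noteq> {}" by (rule dense[unfolded bohr_dense_iff, rule_format, OF B(1)])
  then obtain s where s: "s \<in> steps k" "s \<in> B" by (auto simp: elt_set_plus_def)
  obtain t where "t +o {0, s} \<subseteq> ?SA"
    using B(2)[rule_format, of "{0, s}"] s zero_in_bohr_set[OF B(1)] by auto
  then have t: "t \<in> ?SA" "t + s \<in> ?SA" by (auto simp: elt_set_plus_def)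
  have SA: "x \<in> settled (\<lambda>j. 2 * k j + 1) ((+) 1 ` E)" if x: "x \<in> ?SA" for x
  proof -
    from x obtain s a where "s \<in> steps k" "a \<in> settled (\<lambda>j. 4 * k j + 1) E" "x = s + a"
      by (rule set_plus_elim)
    then show ?thesis
      using settled_add_step[of a "\<lambda>j. 4 * k j + 1" E s k] by (simp add: add.commute[of s a])
  qed
  have "t + s \<in> settled (\<lambda>j. 1) ((+) 1 ` (+) 1 ` E)"
    using settled_add_step[OF SA[OF t(1)] s(1)] by simp
  moreover have "t + s \<in> settled (\<lambda>j. 2 * k j + 1) ((+) 1 ` E)" using SA t(2) by simp
  ultimately obtain N1 N2 where "\<forall>n\<ge>N1. total n (t + s) \<in> (+) 1 ` (+) 1 ` E"
      "\<forall>n\<ge>N2. total n (t + s) \<in> (+) 1 ` E"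
    unfolding settled_def mem_Collect_eq by metis
  from this(1)[rule_format, of "max N1 N2"] this(2)[rule_format, of "max N1 N2"]
  obtain u v where "u \<in> E" "v \<in> E" "1 + (1 + u) = 1 + v" by auto
  then show False using E[of u] by (simp add: add.commute)
qed

section \<open>The translations are Bohr dense\<close>

text \<open>
  To meet \<open>t + B\<close>, use an index with \<open>y n = t\<close> and with enough freedom \<open>k n\<close> to choose the vector on
  the block in the common kernel of the characters that define \<open>B\<close>.
\<close>

lemma bohr_dense_steps:
  assumes "\<And>g N. \<exists>n. y n = g \<and> N \<le> k n"
  shows "bohr_dense (steps k)"
  unfolding bohr_dense_iff
proof (intro allI impI)
  fix t :: "'p Fp_omega" and B :: "'p Fp_omega set" assume "bohr_set B"
  then obtain d :: nat and \<xi> and \<epsilon> :: real where B: "\<epsilon> > 0" "\<forall>j\<in>{1..d}. circle_character (\<xi> j)"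
    "B = {g. \<forall>j\<in>{1..d}. norm (\<xi> j g - 1) < \<epsilon>}" unfolding bohr_set_def by blast
  obtain N where N: "\<forall>I. finite I \<longrightarrow> (\<exists>z. (\<forall>i. i \<notin> I \<longrightarrow> lookup z i = 0)
    \<and> card {i\<in>I. lookup z i \<noteq> 1} \<le> N \<and> (\<forall>j\<in>{1..d}. \<xi> j z = 1))"
    using near_one_in_kernel[of d \<xi>, OF B(2)] by (elim exE)
  obtain n where n: "y n = t" "N \<le> k n" using assms by blast
  obtain z where z: "\<forall>i. i \<notin> block n \<longrightarrow> lookup z i = 0"
      "card {i\<in>block n. lookup z i \<noteq> 1} \<le> N" "\<forall>j\<in>{1..d}. \<xi> j z = 1"
    using N[rule_format, of "block n"] by blast
  have "y n + z \<in> steps k" unfolding steps_def using z n by (intro CollectI exI conjI refl) auto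
  moreover have "z \<in> B" using z(3) B(1) by (simp add: B(3))
  ultimately show "steps k \<inter> (t +o B) \<noteq> {}" unfolding elt_set_plus_def n(1) by blast
qed

section \<open>The density of the settled points\<close>

text \<open>
  Unwinding is a bijection of every large enough window, since it does not change the leader that it
  uses. So at every level the vote is read at a uniformly distributed point, and the union bound
  applies as if nothing had been unwound.
\<close>

lemma card_not_good:
  assumes "b n \<le> B"
  shows "card {x \<in> vecs B. \<not> good n \<mu> x} \<le> (\<Sum>m<n. card {x \<in> vecs B. \<not> (\<exists>a. leads (\<mu> m) (block m) (x :: 'p Fp_omega) a)})"
  using assms
proof (induction n)
  case (Suc n)
  have B: "b n \<le> B" using Suc.prems b_less_Suc[of n] by simp
  have y: "y n \<in> vecs B" using y_below vecs_mono[OF B] by blast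
  have lead: "leader (block n) (x + scale c (y n)) = leader (block n) x" for c x
    by (rule leader_block_cong) (simp add: lookup_add y_eq_0)
  have lead': "leader (block n) (x - scale c (y n)) = leader (block n) x" for c x
    by (rule leader_block_cong) (simp add: lookup_minus y_eq_0)
  let ?rewind = "\<lambda>x. x + scale (leader (block n) x) (y n)"
  have inv: "unwind n (?rewind x) = x" "?rewind (unwind n x) = x" for x
    by (simp_all add: unwind_def lead lead')
  have "card {x \<in> vecs B. \<not> good n \<mu> (unwind n x)} = card {x \<in> vecs B. \<not> good n \<mu> x}"
  proof (rule bij_betw_same_card, rule bij_betwI)
    show "unwind n \<in> {x \<in> vecs B. \<not> good n \<mu> (unwind n x)} \<rightarrow> {x \<in> vecs B. \<not> good n \<mu> x}"
      using y by (auto simp: unwind_def)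
    show "?rewind \<in> {x \<in> vecs B. \<not> good n \<mu> x} \<rightarrow> {x \<in> vecs B. \<not> good n \<mu> (unwind n x)}"
      using y by (simp add: inv Pi_iff)
  qed (use inv in auto)
  moreover have "card {x \<in> vecs B. \<not> good (Suc n) \<mu> x}
      \<le> card ({x \<in> vecs B. \<not> good n \<mu> (unwind n x)} \<union> {x \<in> vecs B. \<not> (\<exists>a. leads (\<mu> n) (block n) (x :: 'p Fp_omega) a)})"
    by (intro card_mono) auto
  moreover have "\<dots> \<le> card {x \<in> vecs B. \<not> good n \<mu> (unwind n x)} + card {x \<in> vecs B. \<not> (\<exists>a. leads (\<mu> n) (block n) (x :: 'p Fp_omega) a)}"
    by (rule card_Un_le)
  ultimately show ?case using Suc.IH[OF B] by simp
qed simp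

text \<open>
  Translation by \<open>y 0\<close> plus the all-one vector of the lowest block has no exceptional coordinates
  and costs no margin. It embeds the points with total \<open>v\<close> into those with total \<open>v + 1\<close>, and
  going around the cyclic group all these sets have the same size.
\<close>

lemma total_equidistributed:
  assumes "N \<ge> 1" "\<mu> 0 > 0"
  shows "CARD('p) * card {x \<in> vecs (b N). good N \<mu> x \<and> total N x \<in> E}
    = card E * card {x \<in> vecs (b N). good N \<mu> x}"
proof -
  define fiber where "fiber v = {x \<in> vecs (b N). good N \<mu> x \<and> total N x = v}" for v
  have fin: "finite (fiber v)" for v by (simp add: fiber_def)
  define s where "s = y 0 + ones (block 0)"
  have "b 0 \<le> b N" "b (Suc 0) \<le> b N" using b_mono assms(1) by auto
  then have s: "s \<in> vecs (b N)" by (auto simp: s_def in_vecs lookup_add lookup_ones y_eq_0)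
  have none: "{i\<in>block 0. lookup (ones (block 0) :: 'p Fp_omega) i \<noteq> 1} = {}"
    by (auto simp: lookup_ones)
  have "card (fiber v) \<le> card (fiber (v + 1))" for v
  proof (rule card_inj_on_le[of "\<lambda>x. x + s"])
    have "total N (x + s) = total N x + 1 \<and> good N (\<mu>(0 := \<mu> 0 - 2 * 0)) (x + s)" if "good N \<mu> x" for x
      unfolding s_def using that assms none by (intro total_add_step) (auto simp: lookup_ones)
    then show "(\<lambda>x. x + s) ` fiber v \<subseteq> fiber (v + 1)" using s by (auto simp: fiber_def)
  qed (auto simp: fin)
  then have "card (fiber v) \<le> card (fiber (v + of_nat m))" for v m
  proof (induction m)
    case (Suc m)
    show ?case using Suc.IH[OF Suc.prems] Suc.prems[of "v + of_nat m"] by (simp add: add.commute add.left_commute)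
  qed simp
  moreover have "\<exists>m. v + of_nat m = w" for v w :: "'p mod_ring"
    using mod_ring_of_nat[of "w - v"] by (metis add.commute diff_add_cancel)
  ultimately have "card (fiber v) \<le> card (fiber w)" for v w by metis
  then have const: "card (fiber v) = card (fiber 0)" for v by (simp add: antisym)
  have sum: "card {x \<in> vecs (b N). good N \<mu> x \<and> total N x \<in> F} = card F * card (fiber 0)" for F
  proof -
    have "{x \<in> vecs (b N). good N \<mu> x \<and> total N x \<in> F} = (\<Union>v\<in>F. fiber v)" by (auto simp: fiber_def)
    then have "card {x \<in> vecs (b N). good N \<mu> x \<and> total N x \<in> F} = (\<Sum>v\<in>F. card (fiber v))"
      by (subst card_UN_disjoint[symmetric]) (auto simp: fiber_def)
    also have "\<dots> = (\<Sum>v\<in>F. card (fiber 0))" by (intro sum.cong refl const)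
    finally show ?thesis by simp
  qed
  show ?thesis using sum[of E] sum[of UNIV] by simp
qed

text \<open>
  The windows are subgroups that exhaust the group, so a fixed translation eventually preserves
  them.
\<close>

lemma folner_vecs: "folner_sequence (\<lambda>n. vecs (b (Suc n)) :: 'p Fp_omega set)"
  unfolding folner_sequence_def
proof (intro conjI allI)
  show "vecs (b (Suc n)) \<noteq> ({} :: 'p Fp_omega set)" for n using vecs_0 by blast
  fix g :: "'p Fp_omega"
  obtain B where B: "g \<in> vecs B" using exhaust_vecs by blast
  have "real (card ((g +o vecs (b (Suc n))) \<inter> vecs (b (Suc n)))) / real (card (vecs (b (Suc n)) :: 'p Fp_omega set)) = 1"
    if "n \<ge> B" for n
  proof -
    have "B \<le> b (Suc n)" using le_b[of "Suc n"] that by simp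
    then have g: "g \<in> vecs (b (Suc n))" using B vecs_mono by blast
    have "g +o vecs (b (Suc n)) = vecs (b (Suc n))"
    proof
      show "vecs (b (Suc n)) \<subseteq> g +o vecs (b (Suc n))"
      proof
        fix x :: "'p Fp_omega" assume "x \<in> vecs (b (Suc n))"
        then have "x - g \<in> vecs (b (Suc n))" "x = g + (x - g)" using g by auto
        then show "x \<in> g +o vecs (b (Suc n))" unfolding elt_set_plus_def by blast
      qed
    qed (use g in \<open>auto simp: elt_set_plus_def\<close>)
    moreover have "card (vecs (b (Suc n)) :: 'p Fp_omega set) \<noteq> 0"
      using card_vecs_pos[of "b (Suc n)", where ?'p = 'p] by linarith
    ultimately show ?thesis by simp
  qed
  then show "(\<lambda>n. real (card ((g +o vecs (b (Suc n))) \<inter> vecs (b (Suc n)))) / real (card (vecs (b (Suc n)) :: 'p Fp_omega set))) \<longlonglongrightarrow> 1"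
    by (intro tendsto_eventually) (auto simp: eventually_sequentially)
qed simp

text \<open>
  On the window \<open>vecs (b (Suc n))\<close> all the blocks from the \<open>Suc n\<close>-th on vanish, so by stability a point
  of the window is settled as soon as the conditions hold at level \<open>Suc n\<close>. There all but a proportion
  \<open>\<eta>\<close> of the points are good, and among the good ones the total is equidistributed.
\<close>

lemma density_settled:
  assumes generic: "\<And>m B. b (Suc m) \<le> B \<Longrightarrow>
      real (card {x \<in> vecs B. \<not> (\<exists>a. leads (\<mu> m) (block m) (x :: 'p Fp_omega) a)})
        \<le> \<delta> m * real (card (vecs B :: 'p Fp_omega set))"
    and \<delta>: "\<And>n. (\<Sum>m<n. \<delta> m) \<le> \<eta>"
    and \<mu>: "\<And>m. \<mu> m \<le> b (Suc m) - b m" "\<mu> 0 > 0"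
  shows "upper_banach_density (settled \<mu> E) \<ge> ereal (real (card E) / real CARD('p) * (1 - \<eta>))"
proof -
  have "real (card E) / real CARD('p) * (1 - \<eta>)
      \<le> real (card (settled \<mu> E \<inter> vecs (b (Suc n)))) / real (card (vecs (b (Suc n)) :: 'p Fp_omega set))" for n
  proof -
    let ?V = "vecs (b (Suc n)) :: 'p Fp_omega set"
    have pos: "real (card ?V) > 0" by simp
    have "real (card {x \<in> ?V. \<not> good (Suc n) \<mu> x})
        \<le> (\<Sum>m<Suc n. real (card {x \<in> ?V. \<not> (\<exists>a. leads (\<mu> m) (block m) x a)}))"
      unfolding of_nat_sum[symmetric] of_nat_le_iff by (rule card_not_good) simp
    also have "\<dots> \<le> (\<Sum>m<Suc n. \<delta> m * real (card ?V))"
      using generic b_mono by (intro sum_mono) auto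
    also have "\<dots> = (\<Sum>m<Suc n. \<delta> m) * real (card ?V)" by (rule sum_distrib_right[symmetric])
    also have "\<dots> \<le> \<eta> * real (card ?V)" by (intro mult_right_mono \<delta>) simp
    finally have bad: "real (card {x \<in> ?V. \<not> good (Suc n) \<mu> x}) \<le> \<eta> * real (card ?V)" .
    have "card ?V = card {x \<in> ?V. good (Suc n) \<mu> x} + card {x \<in> ?V. \<not> good (Suc n) \<mu> x}"
      by (subst card_Un_disjoint[symmetric]) (auto intro: arg_cong[where f = card])
    then have gd: "(1 - \<eta>) * real (card ?V) \<le> real (card {x \<in> ?V. good (Suc n) \<mu> x})"
      using bad by (simp add: algebra_simps)
    have sub: "{x \<in> ?V. good (Suc n) \<mu> x \<and> total (Suc n) x \<in> E} \<subseteq> settled \<mu> E \<inter> ?V"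
    proof
      fix x assume x: "x \<in> {x \<in> ?V. good (Suc n) \<mu> x \<and> total (Suc n) x \<in> E}"
      then have "good m \<mu> x \<and> total m x \<in> E" if "m \<ge> Suc n" for m
        using stable[of x "Suc n" m \<mu>] \<mu>(1) that by simp
      then show "x \<in> settled \<mu> E \<inter> ?V" using x unfolding settled_def by blast
    qed
    have "real CARD('p) * real (card {x \<in> ?V. good (Suc n) \<mu> x \<and> total (Suc n) x \<in> E})
        = real (card E) * real (card {x \<in> ?V. good (Suc n) \<mu> x})"
      unfolding of_nat_mult[symmetric] of_nat_eq_iff using \<mu>(2) by (intro total_equidistributed) auto
    then have "real (card E) / real CARD('p) * real (card {x \<in> ?V. good (Suc n) \<mu> x})
        = real (card {x \<in> ?V. good (Suc n) \<mu> x \<and> total (Suc n) x \<in> E})"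
      by (simp add: field_simps)
    also have "\<dots> \<le> real (card (settled \<mu> E \<inter> ?V))"
      using sub by (simp add: card_mono)
    finally have "real (card E) / real CARD('p) * ((1 - \<eta>) * real (card ?V)) \<le> real (card (settled \<mu> E \<inter> ?V))"
      using mult_left_mono[OF gd, of "real (card E) / real CARD('p)"] by simp
    then show ?thesis using pos by (simp add: pos_le_divide_eq mult.assoc)
  qed
  then have "ereal (real (card E) / real CARD('p) * (1 - \<eta>)) \<le> liminf (\<lambda>n.
      ereal (real (card (settled \<mu> E \<inter> vecs (b (Suc n)))) / real (card (vecs (b (Suc n)) :: 'p Fp_omega set))))"
    by (intro Liminf_bounded) simp
  also have "\<dots> \<le> limsup (\<lambda>n.
      ereal (real (card (settled \<mu> E \<inter> vecs (b (Suc n)))) / real (card (vecs (b (Suc n)) :: 'p Fp_omega set))))"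
    by (rule Liminf_le_Limsup) simp
  also have "\<dots> \<le> upper_banach_density (settled \<mu> E)"
    unfolding upper_banach_density_def by (rule SUP_upper) (simp add: folner_vecs)
  finally show ?thesis .
qed

end

section \<open>Growing blocks and an enumeration of the group\<close>

text \<open>
  The residues \<open>0, 2, \<dots>, p - 3\<close>: the successors are the odd numbers up to \<open>p - 2\<close>, so nothing wraps
  around.
\<close>

lemma ex_half_no_consecutive:
  assumes "odd CARD('p::nontriv)"
  shows "\<exists>E :: 'p mod_ring set. card E = (CARD('p) - 1) div 2 \<and> (\<forall>v\<in>E. v + 1 \<notin> E)"
proof -
  define E where "E = (\<lambda>i. of_nat (2 * i) :: 'p mod_ring) ` {..<(CARD('p) - 1) div 2}"
  have inj: "i = j" if "(of_nat i :: 'p mod_ring) = of_nat j" "i < CARD('p)" "j < CARD('p)" for i j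
  proof -
    have "to_int_mod_ring (of_nat m :: 'p mod_ring) = int m" if "m < CARD('p)" for m
      using that by (simp add: of_nat_of_int_mod_ring)
    then show ?thesis using that by (metis of_nat_eq_iff)
  qed
  have "card E = (CARD('p) - 1) div 2"
    unfolding E_def
  proof (subst card_image)
    show "inj_on (\<lambda>i. of_nat (2 * i) :: 'p mod_ring) {..<(CARD('p) - 1) div 2}"
    proof (rule inj_onI)
      fix i j assume "i \<in> {..<(CARD('p) - 1) div 2}" "j \<in> {..<(CARD('p) - 1) div 2}"
        "(of_nat (2 * i) :: 'p mod_ring) = of_nat (2 * j)"
      then show "i = j" using inj[of "2 * i" "2 * j"] by force
    qed
  qed simp
  moreover have "v + 1 \<notin> E" if v: "v \<in> E" for v
  proof
    assume "v + 1 \<in> E"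
    with v obtain i j where ij: "v = of_nat (2 * i)" "v + 1 = of_nat (2 * j)"
        "i < (CARD('p) - 1) div 2" "j < (CARD('p) - 1) div 2"
      unfolding E_def by blast
    then have "(of_nat (2 * i + 1) :: 'p mod_ring) = of_nat (2 * j)" by (simp add: add.commute)
    then have "2 * i + 1 = 2 * j" using ij(3,4) by (intro inj) auto
    then show False by presburger
  qed
  ultimately show ?thesis by blast
qed

theorem theorem1p8:
  fixes \<epsilon> :: real
  assumes "odd CARD('p::prime_card)" and "\<epsilon> > 0"
  shows "\<exists>S A :: 'p Fp_omega set.
           upper_banach_density A > ereal (1/2 - 1 / (2 * real CARD('p)) - \<epsilon>) \<and>
           bohr_dense S \<and>
           \<not> piecewise_bohr (S + A)"
proof -
  have p3: "CARD('p) \<ge> 3"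
    using assms(1) nontriv[where ?'a = 'p] by (cases "CARD('p) = 2") auto
  \<comment> \<open>The pairing makes every group element occur with every tolerance.\<close>
  define y where "y n = from_nat_into (UNIV :: 'p Fp_omega set) (fst (prod_decode n))" for n
  define k where "k n = snd (prod_decode n)" for n
  define \<mu> where "\<mu> n = 4 * k n + 1" for n
  \<comment> \<open>The proportion of narrow votes tolerated on each block; these sum to \<open>\<epsilon> / 2\<close>.\<close>
  define \<delta> where "\<delta> n = \<epsilon> / 4 * (1/2) ^ n" for n :: nat
  define generic where "generic n l \<longleftrightarrow> (\<forall>I B. I \<subseteq> {..<B} \<and> card I \<ge> l \<longrightarrow>
      real (card {x \<in> vecs B. \<not> (\<exists>a. leads (\<mu> n) I (x :: 'p Fp_omega) a)})
        \<le> \<delta> n * real (card (vecs B :: 'p Fp_omega set)))" for n l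
  have "\<forall>n. \<exists>l. generic n l"
    unfolding generic_def using p3 assms(2) by (intro allI leads_generic) (auto simp: \<delta>_def)
  then obtain L where L: "\<forall>n. generic n (L n)" using choice by blast
  have "\<exists>B. y n \<in> vecs B" for n by (rule exhaust_vecs)
  then obtain bound where bound: "\<And>n. y n \<in> vecs (bound n)" by metis
  \<comment> \<open>Each block is long enough for a clear majority to be typical and for a zero block to count as
    good; its end lies above the support of the next element of the enumeration.\<close>
  define b where "b = rec_nat (bound 0) (\<lambda>n c. max (c + max (L n) (\<mu> n)) (bound (Suc n)))"
  have b: "b 0 = bound 0" "b (Suc n) = max (b n + max (L n) (\<mu> n)) (bound (Suc n))" for n
    by (simp_all add: b_def)
  interpret block_tower b y
  proof
    show "b n < b (Suc n)" for n by (simp add: b \<mu>_def)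
    have "bound n \<le> b n" for n by (cases n) (simp_all add: b)
    then show "y n \<in> vecs (b n)" for n using bound vecs_mono by blast
  qed
  obtain E :: "'p mod_ring set" where E: "card E = (CARD('p) - 1) div 2" "\<And>v. v \<in> E \<Longrightarrow> v + 1 \<notin> E"
    using ex_half_no_consecutive[OF assms(1)] by blast
  have "real (card E) / real CARD('p) = 1/2 - 1 / (2 * real CARD('p))"
    using assms(1) p3 E(1) by (auto elim!: oddE simp: field_simps)
  moreover have "upper_banach_density (settled \<mu> E) \<ge> ereal (real (card E) / real CARD('p) * (1 - \<epsilon> / 2))"
  proof (rule density_settled)
    show "real (card {x \<in> vecs B. \<not> (\<exists>a. leads (\<mu> m) (block m) (x :: 'p Fp_omega) a)})
        \<le> \<delta> m * real (card (vecs B :: 'p Fp_omega set))" if "b (Suc m) \<le> B" for m B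
    proof -
      have "block m \<subseteq> {..<B} \<and> L m \<le> card (block m)" using that by (auto simp: b)
      then show ?thesis by (rule L[rule_format, of m, unfolded generic_def, rule_format])
    qed
    have "(\<Sum>m<n. (1/2 :: real) ^ m) \<le> 2" for n
      using sum_gp_strict[of "1/2 :: real" n] by simp
    then have "\<epsilon> / 4 * (\<Sum>m<n. (1/2 :: real) ^ m) \<le> \<epsilon> / 4 * 2" for n
      using assms(2) by (intro mult_left_mono) auto
    then show "(\<Sum>m<n. \<delta> m) \<le> \<epsilon> / 2" for n
      by (simp add: \<delta>_def sum_distrib_left)
    show "\<mu> m \<le> b (Suc m) - b m" for m by (simp add: b)
  qed (simp add: \<mu>_def)
  moreover have "real (card E) / real CARD('p) * (1 - \<epsilon> / 2) > real (card E) / real CARD('p) - \<epsilon>"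
  proof -
    have *: "q - \<epsilon> < q * (1 - \<epsilon> / 2)" if "q \<le> 1" for q
    proof -
      have "q * (\<epsilon> / 2) \<le> 1 * (\<epsilon> / 2)" using that assms(2) by (intro mult_right_mono) auto
      moreover have "q * (1 - \<epsilon> / 2) = q - q * (\<epsilon> / 2)" by (simp add: algebra_simps)
      ultimately show ?thesis using assms(2) by linarith
    qed
    show ?thesis using E(1) by (intro *) (simp add: divide_le_eq)
  qed
  ultimately have "upper_banach_density (settled \<mu> E) > ereal (1/2 - 1 / (2 * real CARD('p)) - \<epsilon>)"
    by (metis ereal_less_eq(3) less_ereal.simps(1) less_le_trans)
  moreover have dense: "bohr_dense (steps k)"
  proof (rule bohr_dense_steps)
    fix g and N
    obtain i where "from_nat_into (UNIV :: 'p Fp_omega set) i = g"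
      using from_nat_into_surj[OF countable_Fp_omega UNIV_I] by blast
    then show "\<exists>n. y n = g \<and> N \<le> k n"
      by (intro exI[of _ "prod_encode (i, N)"]) (simp add: y_def k_def)
  qed
  moreover have "\<not> piecewise_bohr (steps k + settled \<mu> E)"
    using sumset_not_piecewise_bohr[OF dense E(2)] by (simp add: \<mu>_def[abs_def])
  ultimately show ?thesis by blast
qed

end
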